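(* Let $n\ge0$ be an integer. The singular part $\mathcal{RP}_n\setminus\mathcal S_n$ of the rook partition monoid is generated, as a semigroup, by the set $$\{\overline e_1,\dots,\overline e_n\}\cup\{\overline t_{ij}:1\le i<j\le n\}\cup\{\overline o_1,\dots,\overline o_n\}.$$
   Context: Write $[n]=\{1,\dots,n\}$, $[n]'=\{1',\dots,n'\}$, $[n]''=\{1'',\dots,n''\}$. A rook partition of degree $n$ is a collection of pairwise disjoint non-empty subsets (called blocks) of $[n]\cup[n]'$; elements of $[n]\cup[n]'$ lying in no block are its rook dots. $\mathcal{RP}_n$ is the set of all rook partitions of degree $n$. Product: for $\alpha,\beta\in\mathcal{RP}_n$, relabel each $i'$ of $\alpha$ as $i''$ to get $\alpha_\vee$, and relabel each $i$ of $\beta$ as $i''$ to get $\beta^\wedge$. Let $\Gamma(\alpha,\beta)$ be the graph on $[n]\cup[n]'\cup[n]''$ in which two vertices are adjacent if they lie in a common block of $\alpha_\vee$ or a common block of $\beta^\wedge$; a vertex is white if it is a rook dot of $\alpha_\vee$ or of $\beta^\wedge$, and black otherwise. Then $\alpha\beta$ is the rook partition such that $x\in[n]\cup[n]'$ is a rook dot of $\alpha\beta$ iff $x$ is connected by a (possibly empty) path to a white vertex in $\Gamma(\alpha,\beta)$, and two elements of $[n]\cup[n]'$ that are not rook dots of $\alpha\beta$ are in the same block iff they are connected by a path in $\Gamma(\alpha,\beta)$. This makes $\mathcal{RP}_n$ a monoid. A transversal block is one meeting both $[n]$ and $[n]'$; $\mathcal S_n$ is the set of elements with exactly $n$ transversal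 blocks (the group of units), and $\mathcal{RP}_n\setminus\mathcal S_n$ is an ideal (empty for $n=0$). Elements: $\overline e_i$ has blocks $\{i\},\{i'\}$ and $\{j,j'\}$ for $j\ne i$; $\overline t_{ij}$ has blocks $\{i,j,i',j'\}$ and $\{k,k'\}$ for $k\notin\{i,j\}$; $\overline o_i$ has blocks $\{j,j'\}$ for $j\neq i$ and rook dots $i,i'$. *)

theory Defs
  imports "HOL-Algebra.Group" "HOL-Library.Disjoint_Sets"
begin

text \<open>The vertices \<open>i\<close>, \<open>i'\<close> and \<open>i''\<close> of the product graphs.\<close>

datatype vertex = Upper nat | Lower nat | Middle nat

definition upper :: "nat \<Rightarrow> vertex set" where
  "upper n = Upper ` {1..n}"

definition lower :: "nat \<Rightarrow> vertex set" where
  "lower n = Lower ` {1..n}"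

definition middle :: "nat \<Rightarrow> vertex set" where
  "middle n = Middle ` {1..n}"

text \<open>A rook partition is given by its set of blocks; its rook dots are the
  vertices not covered by a block.\<close>

definition rook_partitions :: "nat \<Rightarrow> vertex set set set" where
  "rook_partitions n =
     {\<alpha>. (\<forall>B\<in>\<alpha>. B \<noteq> {} \<and> B \<subseteq> upper n \<union> lower n) \<and> disjoint \<alpha>}"

fun lower_to_middle :: "vertex \<Rightarrow> vertex" where
  "lower_to_middle (Upper i) = Upper i"
| "lower_to_middle (Lower i) = Middle i"
| "lower_to_middle (Middle i) = Middle i"

fun upper_to_middle :: "vertex \<Rightarrow> vertex" where
  "upper_to_middle (Upper i) = Middle i"
| "upper_to_middle (Lower i) = Lower i"
| "upper_to_middle (Middle i) = Middle i"

definition vee :: "vertex set set \<Rightarrow> vertex set set" where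
  "vee \<alpha> = (\<lambda>B. lower_to_middle ` B) ` \<alpha>"

definition wedge :: "vertex set set \<Rightarrow> vertex set set" where
  "wedge \<beta> = (\<lambda>B. upper_to_middle ` B) ` \<beta>"

text \<open>Adjacency in the product graph. Every vertex covered by a block gets a loop,
  which does not affect connectedness.\<close>

definition product_adj :: "vertex set set \<Rightarrow> vertex set set \<Rightarrow> (vertex \<times> vertex) set" where
  "product_adj \<alpha> \<beta> = {(x, y). \<exists>B \<in> vee \<alpha> \<union> wedge \<beta>. x \<in> B \<and> y \<in> B}"

definition white :: "nat \<Rightarrow> vertex set set \<Rightarrow> vertex set set \<Rightarrow> vertex set" where
  "white n \<alpha> \<beta> =
     ((upper n \<union> middle n) - \<Union>(vee \<alpha>)) \<union> ((middle n \<union> lower n) - \<Union>(wedge \<beta>))"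

definition product_dots :: "nat \<Rightarrow> vertex set set \<Rightarrow> vertex set set \<Rightarrow> vertex set" where
  "product_dots n \<alpha> \<beta> =
     {x \<in> upper n \<union> lower n. \<exists>w \<in> white n \<alpha> \<beta>. (x, w) \<in> (product_adj \<alpha> \<beta>)\<^sup>*}"

definition rook_mult :: "nat \<Rightarrow> vertex set set \<Rightarrow> vertex set set \<Rightarrow> vertex set set" where
  "rook_mult n \<alpha> \<beta> =
     (let X = (upper n \<union> lower n) - product_dots n \<alpha> \<beta>
      in {{y \<in> X. (x, y) \<in> (product_adj \<alpha> \<beta>)\<^sup>*} | x. x \<in> X})"

definition rook_monoid :: "nat \<Rightarrow> vertex set set monoid" where
  "rook_monoid n =
     \<lparr>carrier = rook_partitions n,
      mult = rook_mult n,
      one = {{Upper i, Lower i} | i. i \<in> {1..n}}\<rparr>"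

definition transversal_blocks :: "nat \<Rightarrow> vertex set set \<Rightarrow> vertex set set" where
  "transversal_blocks n \<alpha> = {B \<in> \<alpha>. B \<inter> upper n \<noteq> {} \<and> B \<inter> lower n \<noteq> {}}"

definition rook_units :: "nat \<Rightarrow> vertex set set set" where
  "rook_units n = {\<alpha> \<in> rook_partitions n. card (transversal_blocks n \<alpha>) = n}"

definition e_bar :: "nat \<Rightarrow> nat \<Rightarrow> vertex set set" where
  "e_bar n i = {{Upper i}, {Lower i}} \<union> {{Upper j, Lower j} | j. j \<in> {1..n} - {i}}"

definition t_bar :: "nat \<Rightarrow> nat \<Rightarrow> nat \<Rightarrow> vertex set set" where
  "t_bar n i j = {{Upper i, Upper j, Lower i, Lower j}} \<union>
     {{Upper k, Lower k} | k. k \<in> {1..n} - {i, j}}"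

definition o_bar :: "nat \<Rightarrow> nat \<Rightarrow> vertex set set" where
  "o_bar n i = {{Upper j, Lower j} | j. j \<in> {1..n} - {i}}"

text \<open>Unlike \<open>generate\<close>, the closure adds neither the identity nor inverses, so the
  empty set generates the empty semigroup.\<close>

inductive_set semigroup_generate :: "('a, 'b) monoid_scheme \<Rightarrow> 'a set \<Rightarrow> 'a set"
  for G and A where
    incl: "a \<in> A \<Longrightarrow> a \<in> semigroup_generate G A"
  | mult: "a \<in> semigroup_generate G A \<Longrightarrow> b \<in> semigroup_generate G A
            \<Longrightarrow> a \<otimes>\<^bsub>G\<^esub> b \<in> semigroup_generate G A"

end

theory Submission
  imports Defs
begin

text \<open>Give every vertex a label, where label 0 marks the rook dots and the blocks are the fibres of
  the other labels. Right multiplication by \<open>t_bar n i j\<close> merges the classes of \<open>i'\<close> and \<open>j'\<close>,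
  right multiplication by \<open>o_bar n i\<close> turns the class of \<open>i'\<close> into rook dots, and right
  multiplication by \<open>e_bar n i\<close> makes \<open>{i'}\<close> a block; left multiplication does the same to the
  upper row, since exchanging the rows is an anti-automorphism fixing all generators.

  Read backwards, the first two operations allow a vertex that is a rook dot, or that shares its
  block with a vertex of the same row, to be split off as a singleton block. So a singular element
  reduces to a singular partial matching, in which every block has at most one vertex in each row.
  Read backwards, \<open>e_bar n i\<close> allows a singleton \<open>{i'}\<close> to be inserted into any block. Inserting and
  then splitting moves the hole \<open>i'\<close> to any other place, as in a sliding puzzle; in this way the
  number of blocks of the form \<open>{i, i'}\<close> can be increased until some \<open>e_bar n b\<close> is reached.
  Conversely, a left factor of a unit is a unit, so all products of generators are singular.\<close>

subsection \<open>Rook partitions as fibres of labellings\<close>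

text \<open>With labels, moving a vertex to another block is a function update. Only the values on
  the two outer rows matter, and relabelling the fibres does not change the result as long as 0
  stays fixed.\<close>

definition labelled_blocks :: "nat \<Rightarrow> (vertex \<Rightarrow> nat) \<Rightarrow> vertex set set" where
  "labelled_blocks n f =
     (\<lambda>x. {y \<in> upper n \<union> lower n. f y = f x}) ` {x \<in> upper n \<union> lower n. f x \<noteq> 0}"

lemma finite_vertices: "finite (upper n \<union> lower n)"
  by (simp add: upper_def lower_def)

lemma Upper_in_upper [simp]: "Upper i \<in> upper n \<longleftrightarrow> 1 \<le> i \<and> i \<le> n"
  and Upper_in_lower [simp]: "Upper i \<notin> lower n"
  and Upper_in_middle [simp]: "Upper i \<notin> middle n"
  and Lower_in_upper [simp]: "Lower i \<notin> upper n"
  and Lower_in_lower [simp]: "Lower i \<in> lower n \<longleftrightarrow> 1 \<le> i \<and> i \<le> n"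
  and Lower_in_middle [simp]: "Lower i \<notin> middle n"
  and Middle_in_upper [simp]: "Middle i \<notin> upper n"
  and Middle_in_lower [simp]: "Middle i \<notin> lower n"
  and Middle_in_middle [simp]: "Middle i \<in> middle n \<longleftrightarrow> 1 \<le> i \<and> i \<le> n"
  by (auto simp: upper_def lower_def middle_def)

lemma labelled_blocks_exists:
  assumes "\<alpha> \<in> rook_partitions n"
  obtains f where "\<alpha> = labelled_blocks n f"
proof -
  have sub: "B \<subseteq> upper n \<union> lower n" "B \<noteq> {}" if "B \<in> \<alpha>" for B
    using assms that by (auto simp: rook_partitions_def)
  have "finite \<alpha>"
    using finite_vertices[of n] sub by (meson PowI finite_Pow_iff finite_subset subsetI)
  then obtain g :: "vertex set \<Rightarrow> nat" where g: "inj_on g \<alpha>"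
    using finite_imp_inj_to_nat_seg by blast
  have uniq: "B = C" if "B \<in> \<alpha>" "C \<in> \<alpha>" "x \<in> B" "x \<in> C" for B C x
    using assms that by (auto simp: rook_partitions_def disjoint_def)
  \<comment> \<open>The blocks are numbered by the injection \<open>g\<close>. \<open>Suc\<close>
    keeps 0 free for the rook dots, and \<open>THE\<close> is justified by disjointness.\<close>
  define f where "f x = (if x \<in> \<Union>\<alpha> then Suc (g (THE B. B \<in> \<alpha> \<and> x \<in> B)) else 0)" for x
  have f: "f x = Suc (g B)" if "B \<in> \<alpha>" "x \<in> B" for x B
  proof -
    have "(THE B. B \<in> \<alpha> \<and> x \<in> B) = B"
    proof (rule the_equality)
      show "C = B" if "C \<in> \<alpha> \<and> x \<in> C" for C
        using uniq[of C B x] that \<open>B \<in> \<alpha>\<close> \<open>x \<in> B\<close> by simp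
    qed (use that in simp)
    then show ?thesis
      using that by (auto simp: f_def)
  qed
  have cls: "{y \<in> upper n \<union> lower n. f y = f x} = B" if "B \<in> \<alpha>" "x \<in> B" for x B
  proof
    show "{y \<in> upper n \<union> lower n. f y = f x} \<subseteq> B"
    proof
      fix y assume "y \<in> {y \<in> upper n \<union> lower n. f y = f x}"
      then have y: "f y = Suc (g B)"
        using f that by auto
      then obtain C where "C \<in> \<alpha>" "y \<in> C"
        by (auto simp: f_def split: if_splits)
      then show "y \<in> B"
        using f[of C y] y g that by (auto dest: inj_onD)
    qed
    show "B \<subseteq> {y \<in> upper n \<union> lower n. f y = f x}"
      using f that sub by auto
  qed
  have "\<alpha> = labelled_blocks n f"
  proof
    show "\<alpha> \<subseteq> labelled_blocks n f"
    proof
      fix B assume B: "B \<in> \<alpha>"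
      then obtain x where "x \<in> B"
        using sub(2)[OF B] by blast
      then show "B \<in> labelled_blocks n f"
        using cls[OF B] f[OF B] sub B unfolding labelled_blocks_def
        by (intro image_eqI[where x = x]) auto
    qed
    show "labelled_blocks n f \<subseteq> \<alpha>"
    proof
      fix B assume "B \<in> labelled_blocks n f"
      then obtain x where x: "B = {y \<in> upper n \<union> lower n. f y = f x}" "f x \<noteq> 0"
        by (auto simp: labelled_blocks_def)
      then obtain C where "C \<in> \<alpha>" "x \<in> C"
        by (metis UnionE f_def)
      then show "B \<in> \<alpha>"
        using cls x by auto
    qed
  qed
  then show thesis
    by (rule that)
qed

section \<open>Products read off from labellings of the product graph\<close>

lemma sym_product_adj: "sym (product_adj \<alpha> \<beta>)"
  by (auto simp: sym_def product_adj_def)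

lemma rook_mult_in_rook_partitions: "rook_mult n \<alpha> \<beta> \<in> rook_partitions n"
proof -
  have "sym ((product_adj \<alpha> \<beta>)\<^sup>*)"
    by (simp add: sym_product_adj sym_rtrancl)
  then show ?thesis
    unfolding rook_partitions_def rook_mult_def Let_def disjoint_def
    by (auto dest: symD intro: rtrancl_trans)
qed

text \<open>Here \<open>k\<close> labels all three rows. By \<open>adj\<close> it is constant on the
  components of the product graph; by \<open>conn\<close> a nonzero fibre on the outer rows lies in
  one component; by \<open>white\<close> and \<open>dots\<close> the label 0 marks exactly the outer
  vertices connected to a white vertex. So the fibres of \<open>k\<close> are the blocks of the
  product.\<close>

lemma rook_mult_eq_labelled_blocks:
  assumes adj: "\<And>x y. (x, y) \<in> product_adj \<alpha> \<beta> \<Longrightarrow> k x = k y"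
    and white: "\<And>w. w \<in> white n \<alpha> \<beta> \<Longrightarrow> k w = 0"
    and conn: "\<And>x y. x \<in> upper n \<union> lower n \<Longrightarrow> y \<in> upper n \<union> lower n \<Longrightarrow> k x = k y \<Longrightarrow>
      k x \<noteq> 0 \<Longrightarrow> (x, y) \<in> (product_adj \<alpha> \<beta>)\<^sup>*"
    and dots: "\<And>x. x \<in> upper n \<union> lower n \<Longrightarrow> k x = 0 \<Longrightarrow>
      \<exists>w \<in> white n \<alpha> \<beta>. (x, w) \<in> (product_adj \<alpha> \<beta>)\<^sup>*"
  shows "rook_mult n \<alpha> \<beta> = labelled_blocks n k"
proof -
  have path: "k x = k y" if "(x, y) \<in> (product_adj \<alpha> \<beta>)\<^sup>*" for x y
    using that by (induction rule: rtrancl_induct) (auto dest: adj)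
  have "product_dots n \<alpha> \<beta> = {x \<in> upper n \<union> lower n. k x = 0}"
    using dots white path unfolding product_dots_def by fastforce
  then have X: "upper n \<union> lower n - product_dots n \<alpha> \<beta> = {x \<in> upper n \<union> lower n. k x \<noteq> 0}"
    by auto
  have "(x, y) \<in> (product_adj \<alpha> \<beta>)\<^sup>* \<longleftrightarrow> k y = k x"
    if "x \<in> upper n \<union> lower n" "k x \<noteq> 0" "y \<in> upper n \<union> lower n" for x y
    using that conn[of x y] path[of x y] by metis
  then have "{y \<in> {x \<in> upper n \<union> lower n. k x \<noteq> 0}. (x, y) \<in> (product_adj \<alpha> \<beta>)\<^sup>*}
      = {y \<in> upper n \<union> lower n. k y = k x}" if "x \<in> upper n \<union> lower n" "k x \<noteq> 0" for x
    using that by auto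
  then show ?thesis
    unfolding rook_mult_def Let_def X labelled_blocks_def by blast
qed

lemma Upper_in_lower_to_middle [simp]: "Upper i \<in> lower_to_middle ` B \<longleftrightarrow> Upper i \<in> B"
proof -
  have "lower_to_middle x = Upper i \<longleftrightarrow> x = Upper i" for x
    by (cases x; auto)
  then show ?thesis
    by (metis image_iff)
qed

subsection \<open>Exchanging the two rows\<close>

text \<open>The middle row is fixed, so exchanging the outer rows carries the product graph of two
  factors to that of the exchanged factors in reverse order.\<close>

fun flip :: "vertex \<Rightarrow> vertex" where
  "flip (Upper i) = Lower i"
| "flip (Lower i) = Upper i"
| "flip (Middle i) = Middle i"

lemma flip_flip [simp]: "flip (flip x) = x"
  by (cases x) auto

lemma flip_in_upper [simp]: "flip x \<in> upper n \<longleftrightarrow> x \<in> lower n"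
  and flip_in_lower [simp]: "flip x \<in> lower n \<longleftrightarrow> x \<in> upper n"
  and flip_in_middle [simp]: "flip x \<in> middle n \<longleftrightarrow> x \<in> middle n"
  by (cases x; simp)+

lemma flip_image_iff: "x \<in> flip ` B \<longleftrightarrow> flip x \<in> B"
  by (metis flip_flip image_eqI imageE)

lemma lower_to_middle_flip: "lower_to_middle (flip x) = flip (upper_to_middle x)"
  and upper_to_middle_flip: "upper_to_middle (flip x) = flip (lower_to_middle x)"
  by (cases x; simp)+

lemma vee_flip: "vee ((`) flip ` \<beta>) = (`) flip ` wedge \<beta>"
  and wedge_flip: "wedge ((`) flip ` \<alpha>) = (`) flip ` vee \<alpha>"
  by (simp_all add: vee_def wedge_def image_image lower_to_middle_flip upper_to_middle_flip)

lemma product_adj_flip: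
  "(flip x, flip y) \<in> product_adj ((`) flip ` \<beta>) ((`) flip ` \<alpha>) \<longleftrightarrow> (x, y) \<in> product_adj \<alpha> \<beta>"
  by (simp add: product_adj_def vee_flip wedge_flip bex_Un flip_image_iff) blast

lemma white_flip: "white n ((`) flip ` \<beta>) ((`) flip ` \<alpha>) = flip ` white n \<alpha> \<beta>"
proof (rule Set.set_eqI)
  show "x \<in> white n ((`) flip ` \<beta>) ((`) flip ` \<alpha>) \<longleftrightarrow> x \<in> flip ` white n \<alpha> \<beta>" for x
    by (simp add: white_def vee_flip wedge_flip flip_image_iff) blast
qed

lemma flip_flip_image [simp]: "(`) flip ` (`) flip ` \<alpha> = \<alpha>"
  by (simp add: image_image)

lemma product_adj_rtrancl_flip:
  "(flip x, flip y) \<in> (product_adj ((`) flip ` \<beta>) ((`) flip ` \<alpha>))\<^sup>*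
    \<longleftrightarrow> (x, y) \<in> (product_adj \<alpha> \<beta>)\<^sup>*"
proof -
  have imp: "(flip x, flip y) \<in> (product_adj ((`) flip ` \<beta>) ((`) flip ` \<alpha>))\<^sup>*"
    if "(x, y) \<in> (product_adj \<alpha> \<beta>)\<^sup>*" for x y \<alpha> \<beta>
    using that
  proof (induction rule: rtrancl_induct)
    case (step y z)
    then show ?case
      by (metis product_adj_flip rtrancl.rtrancl_into_rtrancl)
  qed simp
  \<comment> \<open>Since \<open>flip\<close> is an involution, the converse is the same implication
    applied to the exchanged factors.\<close>
  show ?thesis
    using imp[of x y \<alpha> \<beta>] imp[of "flip x" "flip y" "(`) flip ` \<beta>" "(`) flip ` \<alpha>"] by auto
qed

lemma product_dots_flip:
  "flip x \<in> product_dots n ((`) flip ` \<beta>) ((`) flip ` \<alpha>) \<longleftrightarrow> x \<in> product_dots n \<alpha> \<beta>"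
  by (simp add: product_dots_def white_flip product_adj_rtrancl_flip disj_commute)

text \<open>The anti-automorphism property: \<open>flip\<close> maps the undotted vertices of one
  product onto those of the other and preserves connectedness, hence maps classes to
  classes.\<close>

lemma rook_mult_flip:
  "rook_mult n ((`) flip ` \<beta>) ((`) flip ` \<alpha>) = (`) flip ` rook_mult n \<alpha> \<beta>"
proof -
  let ?V = "upper n \<union> lower n"
  let ?X = "?V - product_dots n \<alpha> \<beta>"
  let ?Y = "?V - product_dots n ((`) flip ` \<beta>) ((`) flip ` \<alpha>)"
  let ?R = "(product_adj \<alpha> \<beta>)\<^sup>*"
  let ?S = "(product_adj ((`) flip ` \<beta>) ((`) flip ` \<alpha>))\<^sup>*"
  have Y: "?Y = flip ` ?X"
  proof (rule Set.set_eqI)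
    show "x \<in> ?Y \<longleftrightarrow> x \<in> flip ` ?X" for x
      using product_dots_flip[of "flip x" n \<beta> \<alpha>] by (simp add: flip_image_iff disj_commute)
  qed
  have cls: "{y \<in> ?Y. (flip x, y) \<in> ?S} = flip ` {y \<in> ?X. (x, y) \<in> ?R}" for x
    unfolding Y using product_adj_rtrancl_flip[of x _ \<beta> \<alpha>] by blast
  have "rook_mult n ((`) flip ` \<beta>) ((`) flip ` \<alpha>) = (\<lambda>x. {y \<in> ?Y. (x, y) \<in> ?S}) ` ?Y"
    unfolding rook_mult_def Let_def by blast
  \<comment> \<open>Only the index set is transported here; the \<open>?Y\<close> inside the classes
    is treated by \<open>cls\<close>.\<close>
  also have "\<dots> = (\<lambda>x. {y \<in> ?Y. (flip x, y) \<in> ?S}) ` ?X"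
    by (subst (2) Y) (simp only: image_image)
  also have "\<dots> = (\<lambda>x. flip ` {y \<in> ?X. (x, y) \<in> ?R}) ` ?X"
    by (simp only: cls)
  also have "\<dots> = (`) flip ` rook_mult n \<alpha> \<beta>"
    unfolding rook_mult_def Let_def by blast
  finally show ?thesis .
qed

lemma labelled_blocks_flip: "labelled_blocks n (f \<circ> flip) = (`) flip ` labelled_blocks n f"
proof -
  have V: "{x \<in> upper n \<union> lower n. f (flip x) \<noteq> 0} = flip ` {x \<in> upper n \<union> lower n. f x \<noteq> 0}"
    by (auto simp: flip_image_iff)
  have "{y \<in> upper n \<union> lower n. f (flip y) = f x} = flip ` {y \<in> upper n \<union> lower n. f y = f x}" for x
    by (auto simp: flip_image_iff)
  then show ?thesis
    unfolding labelled_blocks_def comp_def V by (simp add: image_image)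
qed

lemma e_bar_flip: "(`) flip ` e_bar n i = e_bar n i"
  and o_bar_flip: "(`) flip ` o_bar n i = o_bar n i"
  and t_bar_flip: "(`) flip ` t_bar n i j = t_bar n i j"
  by (simp_all add: e_bar_def o_bar_def t_bar_def setcompr_eq_image image_Un image_image insert_commute)

subsection \<open>Units\<close>

text \<open>Transversal blocks are disjoint and each meets the upper row of \<open>n\<close>
  vertices. If there are \<open>n\<close> of them, none can take two upper vertices. This criterion
  looks at \<alpha> from the upper row, which suits the analysis of left factors.\<close>

lemma rook_units_iff:
  assumes "\<alpha> \<in> rook_partitions n"
  shows "\<alpha> \<in> rook_units n \<longleftrightarrow>
    (\<forall>x\<in>upper n. \<exists>B\<in>\<alpha>. B \<inter> upper n = {x} \<and> B \<inter> lower n \<noteq> {})"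
proof
  let ?T = "transversal_blocks n \<alpha>"
  have uniq: "B = C" if "B \<in> \<alpha>" "C \<in> \<alpha>" "x \<in> B" "x \<in> C" for B C x
    using assms that by (auto simp: rook_partitions_def disjoint_def)
  have upper: "finite (upper n)" "card (upper n) = n"
    by (auto simp: upper_def card_image inj_on_def)
  {
    assume "\<alpha> \<in> rook_units n"
    then have card: "card ?T = n"
      by (simp add: rook_units_def)
    have "\<forall>B\<in>?T. \<exists>x. x \<in> B \<inter> upper n"
      by (auto simp: transversal_blocks_def)
    then obtain g where g: "\<forall>B\<in>?T. g B \<in> B \<inter> upper n"
      by metis
    have T: "B \<in> \<alpha>" if "B \<in> ?T" for B
      using that by (simp add: transversal_blocks_def)
    have "inj_on g ?T"
      using g T uniq by (metis IntD1 inj_onI)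
    moreover have "g ` ?T \<subseteq> upper n"
      using g by auto
    \<comment> \<open>An injection from \<open>n\<close> blocks into \<open>n\<close> upper vertices
      is onto.\<close>
    ultimately have img: "g ` ?T = upper n"
      using upper card by (metis card_image card_subset_eq)
    show "\<forall>x\<in>upper n. \<exists>B\<in>\<alpha>. B \<inter> upper n = {x} \<and> B \<inter> lower n \<noteq> {}"
    proof
      fix x assume "x \<in> upper n"
      then obtain B where B: "B \<in> ?T" "x = g B"
        using img by blast
      have "y = x" if "y \<in> B" "y \<in> upper n" for y
      proof -
        obtain C where C: "C \<in> ?T" "y = g C"
          using img \<open>y \<in> upper n\<close> by blast
        then have "C = B"
          using uniq[of C B y] T B g that by blast
        then show ?thesis
          using B C by simp
      qed
      then have "B \<inter> upper n = {x}"
        using B g by blast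
      then show "\<exists>B\<in>\<alpha>. B \<inter> upper n = {x} \<and> B \<inter> lower n \<noteq> {}"
        using B by (auto simp: transversal_blocks_def)
    qed
  }
  assume "\<forall>x\<in>upper n. \<exists>B\<in>\<alpha>. B \<inter> upper n = {x} \<and> B \<inter> lower n \<noteq> {}"
  then obtain h where h: "\<And>x. x \<in> upper n \<Longrightarrow> h x \<in> \<alpha> \<and> h x \<inter> upper n = {x} \<and> h x \<inter> lower n \<noteq> {}"
    by metis
  have "?T = h ` upper n"
  proof
    show "?T \<subseteq> h ` upper n"
    proof
      fix B assume "B \<in> ?T"
      then obtain x where x: "B \<in> \<alpha>" "x \<in> B" "x \<in> upper n"
        by (auto simp: transversal_blocks_def)
      moreover have "x \<in> h x"
        using h x by blast
      ultimately have "B = h x"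
        using uniq[of B "h x" x] h by blast
      then show "B \<in> h ` upper n"
        using x by blast
    qed
    show "h ` upper n \<subseteq> ?T"
      using h by (auto simp: transversal_blocks_def)
  qed
  moreover have "inj_on h (upper n)"
    using h by (metis inj_onI singleton_inject)
  ultimately show "\<alpha> \<in> rook_units n"
    using assms upper by (simp add: rook_units_def card_image)
qed

text \<open>Let \<open>K\<close> be the block of \<alpha> through an upper vertex \<open>x\<close>.
  The upper vertices of \<open>K\<close> are connected to \<open>x\<close>, so they lie in its block
  in the product, whose upper part is \<open>{x}\<close>. If \<open>K\<close> missed the lower row,
  \<open>x\<close> would have no other neighbour in the product graph and its block in the product
  could not reach the lower row.\<close>

lemma rook_units_of_rook_mult:
  assumes \<alpha>: "\<alpha> \<in> rook_partitions n" and "rook_mult n \<alpha> \<beta> \<in> rook_units n"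
  shows "\<alpha> \<in> rook_units n"
  unfolding rook_units_iff[OF \<alpha>]
proof
  let ?R = "(product_adj \<alpha> \<beta>)\<^sup>*"
  let ?X = "upper n \<union> lower n - product_dots n \<alpha> \<beta>"
  fix x assume x: "x \<in> upper n"
  then obtain i where i: "x = Upper i"
    by (auto simp: upper_def)
  have sym: "(b, a) \<in> ?R" if "(a, b) \<in> ?R" for a b
    using that sym_product_adj by (metis sym_rtrancl symD)
  have "\<forall>x\<in>upper n. \<exists>B\<in>rook_mult n \<alpha> \<beta>. B \<inter> upper n = {x} \<and> B \<inter> lower n \<noteq> {}"
    using assms(2) rook_units_iff[OF rook_mult_in_rook_partitions] by simp
  from bspec[OF this x] obtain B where "B \<in> rook_mult n \<alpha> \<beta>" and B: "B \<inter> upper n = {x}" "B \<inter> lower n \<noteq> {}"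
    by blast
  then obtain x0 where x0: "B = {y \<in> ?X. (x0, y) \<in> ?R}"
    by (auto simp: rook_mult_def Let_def)
  then have "x \<in> ?X" "(x0, x) \<in> ?R"
    using B by auto
  \<comment> \<open>The block comes with some representative \<open>x0\<close>; symmetry and
    transitivity allow \<open>x\<close> in its place.\<close>
  then have cls: "B = {y \<in> ?X. (x, y) \<in> ?R}"
    unfolding x0 using sym by (blast intro: rtrancl_trans)
  have "x \<notin> white n \<alpha> \<beta>"
    using \<open>x \<in> ?X\<close> by (auto simp: product_dots_def)
  then obtain K where K: "K \<in> \<alpha>" "x \<in> K"
    using x i by (auto simp: white_def vee_def)
  have "y = x" if "y \<in> K" "y \<in> upper n" for y
  proof -
    obtain j where j: "y = Upper j"
      using \<open>y \<in> upper n\<close> by (auto simp: upper_def)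
    have "(x, y) \<in> product_adj \<alpha> \<beta>"
      unfolding product_adj_def mem_Collect_eq case_prod_conv
    proof (rule bexI)
      show "x \<in> lower_to_middle ` K \<and> y \<in> lower_to_middle ` K"
        using K \<open>y \<in> K\<close> i j by simp
      show "lower_to_middle ` K \<in> vee \<alpha> \<union> wedge \<beta>"
        using K by (simp add: vee_def)
    qed
    then have "(x, y) \<in> ?R" ..
    moreover have "y \<in> ?X"
      using \<open>(x, y) \<in> ?R\<close> \<open>x \<in> ?X\<close> that x
      by (auto simp: product_dots_def intro: rtrancl_trans)
    ultimately have "y \<in> B"
      using cls by blast
    then show ?thesis
      using B that by blast
  qed
  then have "K \<inter> upper n = {x}"
    using K x by blast
  moreover have "K \<inter> lower n \<noteq> {}"
  proof
    assume "K \<inter> lower n = {}"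
    then have K1: "K = {x}"
      using \<open>K \<inter> upper n = {x}\<close> \<alpha> K by (auto simp: rook_partitions_def)
    \<comment> \<open>Blocks of \<open>wedge \<beta>\<close> contain no upper vertex, and the only
      block of \<alpha> through \<open>x\<close> is \<open>K = {x}\<close>.\<close>
    have nbr: "z = x" if xz: "(x, z) \<in> product_adj \<alpha> \<beta>" for z
    proof -
      obtain C where C: "C \<in> vee \<alpha> \<union> wedge \<beta>" "x \<in> C" "z \<in> C"
        using xz by (auto simp: product_adj_def)
      have "x \<notin> upper_to_middle ` D" for D
      proof -
        have "upper_to_middle v \<noteq> Upper i" for v
          by (cases v) auto
        then show ?thesis
          unfolding i by (metis imageE)
      qed
      then obtain D where D: "D \<in> \<alpha>" "C = lower_to_middle ` D"
        using C by (auto simp: vee_def wedge_def)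
      then have "x \<in> D"
        using C i by simp
      then have "D = K"
        using D K \<alpha> by (auto simp: rook_partitions_def disjoint_def)
      then show ?thesis
        using C D K1 i by simp
    qed
    have "z = x" if "(x, z) \<in> ?R" for z
      using that by (induction rule: rtrancl_induct) (auto dest: nbr)
    then have "B \<subseteq> {x}"
      using cls by blast
    then have "B \<inter> lower n \<subseteq> {x} \<inter> lower n"
      by blast
    then show False
      using B(2) i by simp
  qed
  ultimately show "\<exists>B\<in>\<alpha>. B \<inter> upper n = {x} \<and> B \<inter> lower n \<noteq> {}"
    using K by blast
qed

subsection \<open>Multiplication by the generators\<close>

lemma lower_to_middle_eq_iff:
  "x \<in> upper n \<union> lower n \<Longrightarrow> y \<in> upper n \<union> lower n \<Longrightarrow>
    lower_to_middle x = lower_to_middle y \<longleftrightarrow> x = y"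
  by (cases x; cases y) auto

text \<open>The main condition is \<open>reach\<close>: an outer vertex is joined to the copy of a
  vertex of the left factor that already has the right label, or is itself white, or is alone in its
  fibre. Two vertices with the same nonzero label then meet inside a block of the left factor, and a
  vertex labelled 0 reaches a rook dot.\<close>

lemma rook_mult_labelled_blocks:
  assumes vee: "\<And>x y. x \<in> upper n \<union> lower n \<Longrightarrow> y \<in> upper n \<union> lower n \<Longrightarrow> f x = f y \<Longrightarrow> f x \<noteq> 0 \<Longrightarrow>
      k (lower_to_middle x) = k (lower_to_middle y)"
    and vee_dot: "\<And>x. x \<in> upper n \<union> lower n \<Longrightarrow> f x = 0 \<Longrightarrow> k (lower_to_middle x) = 0"
    and wedge: "\<And>B x y. B \<in> wedge \<beta> \<Longrightarrow> x \<in> B \<Longrightarrow> y \<in> B \<Longrightarrow> k x = k y"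
    and wedge_dot: "\<And>w. w \<in> middle n \<union> lower n \<Longrightarrow> w \<notin> \<Union>(wedge \<beta>) \<Longrightarrow> k w = 0"
    and reach: "\<And>x. x \<in> upper n \<union> lower n \<Longrightarrow>
      (\<exists>y \<in> upper n \<union> lower n. f y = k x \<and>
        (x, lower_to_middle y) \<in> (product_adj (labelled_blocks n f) \<beta>)\<^sup>*) \<or>
      k x = 0 \<and> x \<in> white n (labelled_blocks n f) \<beta> \<or>
      k x \<noteq> 0 \<and> (\<forall>y \<in> upper n \<union> lower n. k y = k x \<longrightarrow> y = x)"
  shows "rook_mult n (labelled_blocks n f) \<beta> = labelled_blocks n k"
proof (rule rook_mult_eq_labelled_blocks)
  let ?\<alpha> = "labelled_blocks n f"
  let ?R = "product_adj ?\<alpha> \<beta>"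
  have block: "lower_to_middle ` {z \<in> upper n \<union> lower n. f z = f x} \<in> vee ?\<alpha>"
    if "x \<in> upper n \<union> lower n" "f x \<noteq> 0" for x
    using that unfolding vee_def labelled_blocks_def by blast
  then have covered: "lower_to_middle x \<in> \<Union>(vee ?\<alpha>)"
    if "x \<in> upper n \<union> lower n" "f x \<noteq> 0" for x
    using that by (intro UnionI[OF block[of x]]) auto
  have edge: "(lower_to_middle x, lower_to_middle y) \<in> ?R"
    if "x \<in> upper n \<union> lower n" "y \<in> upper n \<union> lower n" "f x = f y" "f x \<noteq> 0" for x y
    unfolding product_adj_def mem_Collect_eq case_prod_conv
    by (rule bexI[OF _ UnI1[OF block[of x]]]) (use that in auto)
  show "k a = k b" if ab: "(a, b) \<in> ?R" for a b
  proof -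
    obtain B where B: "B \<in> vee ?\<alpha> \<union> wedge \<beta>" "a \<in> B" "b \<in> B"
      using ab by (auto simp: product_adj_def)
    show ?thesis
    proof (cases "B \<in> wedge \<beta>")
      case True
      then show ?thesis
        using wedge B by blast
    next
      case False
      then obtain z where "B = lower_to_middle ` {y \<in> upper n \<union> lower n. f y = f z}" "f z \<noteq> 0"
        using B unfolding vee_def labelled_blocks_def by blast
      then obtain x y where "x \<in> upper n \<union> lower n" "y \<in> upper n \<union> lower n" "f x = f z" "f y = f z"
        "f z \<noteq> 0" "a = lower_to_middle x" "b = lower_to_middle y"
        using B by blast
      then show ?thesis
        using vee by metis
    qed
  qed
  show "k w = 0" if w: "w \<in> white n ?\<alpha> \<beta>" for w
  proof (cases "w \<in> (middle n \<union> lower n) - \<Union>(wedge \<beta>)")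
    case True
    then show ?thesis
      using wedge_dot by blast
  next
    case False
    then have "w \<in> upper n \<union> middle n" "w \<notin> \<Union>(vee ?\<alpha>)"
      using w by (auto simp: white_def)
    \<comment> \<open>Every upper or middle vertex is the copy of a vertex of the left factor, so
      the label of \<open>w\<close> is governed by \<open>f\<close>.\<close>
    obtain x where x: "x \<in> upper n \<union> lower n" "w = lower_to_middle x"
    proof (cases w)
      case (Upper i)
      then show ?thesis
        using that[of "Upper i"] \<open>w \<in> upper n \<union> middle n\<close> by simp
    next
      case (Middle i)
      then show ?thesis
        using that[of "Lower i"] \<open>w \<in> upper n \<union> middle n\<close> by simp
    qed (use \<open>w \<in> upper n \<union> middle n\<close> in simp)
    then have "f x = 0"
      using covered \<open>w \<notin> \<Union>(vee ?\<alpha>)\<close> by metis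
    then show ?thesis
      using vee_dot[OF x(1)] x(2) by simp
  qed
  have dot: "lower_to_middle x \<in> white n ?\<alpha> \<beta>" if x: "x \<in> upper n \<union> lower n" "f x = 0" for x
  proof -
    have "lower_to_middle x \<notin> \<Union>(vee ?\<alpha>)"
    proof
      assume "lower_to_middle x \<in> \<Union>(vee ?\<alpha>)"
      then obtain z y where "f z \<noteq> 0" "y \<in> upper n \<union> lower n" "f y = f z"
        "lower_to_middle x = lower_to_middle y"
        by (auto simp: vee_def labelled_blocks_def)
      then show False
        using lower_to_middle_eq_iff[of x n y] x by auto
    qed
    moreover have "lower_to_middle x \<in> upper n \<union> middle n"
      using x by (cases x) auto
    ultimately show ?thesis
      by (simp add: white_def)
  qed
  have sym: "(b, a) \<in> ?R\<^sup>*" if "(a, b) \<in> ?R\<^sup>*" for a b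
    using that sym_product_adj by (metis sym_rtrancl symD)
  show "(x, y) \<in> ?R\<^sup>*"
    if x: "x \<in> upper n \<union> lower n" and y: "y \<in> upper n \<union> lower n" and k: "k x = k y" "k x \<noteq> 0" for x y
  proof (cases "x = y")
    case False
    \<comment> \<open>Distinct vertices with a common nonzero label leave only the first alternative
      of \<open>reach\<close>.\<close>
    obtain x' where x': "x' \<in> upper n \<union> lower n" "f x' = k x" "(x, lower_to_middle x') \<in> ?R\<^sup>*"
      using reach[OF x] y k False by metis
    obtain y' where y': "y' \<in> upper n \<union> lower n" "f y' = k y" "(y, lower_to_middle y') \<in> ?R\<^sup>*"
      using reach[OF y] x k False by metis
    have "(lower_to_middle x', lower_to_middle y') \<in> ?R"
      using edge x' y' k by metis
    then show ?thesis
      using x'(3) sym[OF y'(3)] by (meson rtrancl.rtrancl_into_rtrancl rtrancl_trans)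
  qed simp
  show "\<exists>w \<in> white n ?\<alpha> \<beta>. (x, w) \<in> ?R\<^sup>*" if x: "x \<in> upper n \<union> lower n" and "k x = 0" for x
    using reach[OF x] dot that by (metis rtrancl.rtrancl_refl)
qed

section \<open>The generated semigroup and its symmetry\<close>

abbreviation generators :: "nat \<Rightarrow> vertex set set set" where
  "generators n \<equiv> {e_bar n i | i. 1 \<le> i \<and> i \<le> n}
    \<union> {t_bar n i j | i j. 1 \<le> i \<and> i < j \<and> j \<le> n} \<union> {o_bar n i | i. 1 \<le> i \<and> i \<le> n}"

abbreviation generated :: "nat \<Rightarrow> vertex set set set" where
  "generated n \<equiv> semigroup_generate (rook_monoid n) (generators n)"

lemma e_bar_generated: "i \<in> {1..n} \<Longrightarrow> e_bar n i \<in> generated n"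
  and o_bar_generated: "i \<in> {1..n} \<Longrightarrow> o_bar n i \<in> generated n"
  by (auto intro!: semigroup_generate.incl)

lemma t_bar_generated:
  assumes "i \<in> {1..n}" "j \<in> {1..n}" "i \<noteq> j"
  shows "t_bar n i j \<in> generated n"
proof -
  have comm: "t_bar n i j = t_bar n j i"
    by (simp add: t_bar_def insert_commute)
  have "t_bar n i j \<in> generators n"
  proof (cases "i < j")
    case True
    then show ?thesis
      using assms by auto
  next
    case False
    then have "1 \<le> j \<and> j < i \<and> i \<le> n"
      using assms by auto
    then show ?thesis
      unfolding comm by blast
  qed
  then show ?thesis
    by (rule semigroup_generate.incl)
qed

lemma rook_mult_generated:
  "\<alpha> \<in> generated n \<Longrightarrow> \<beta> \<in> generated n \<Longrightarrow> rook_mult n \<alpha> \<beta> \<in> generated n"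
  using semigroup_generate.mult[of \<alpha> "rook_monoid n" _ \<beta>] by (simp add: rook_monoid_def)

lemma generated_flip:
  assumes "\<alpha> \<in> generated n"
  shows "(`) flip ` \<alpha> \<in> generated n"
  using assms
proof (induction rule: semigroup_generate.induct)
  case (incl \<alpha>)
  then have eq: "(`) flip ` \<alpha> = \<alpha>"
    by (elim UnE CollectE exE conjE) (simp_all only: e_bar_flip o_bar_flip t_bar_flip)
  show ?case
    unfolding eq using incl by (rule semigroup_generate.incl)
next
  case (mult \<alpha> \<beta>)
  then show ?case
    using rook_mult_generated by (simp add: rook_monoid_def rook_mult_flip[symmetric])
qed

text \<open>Because of this symmetry it suffices to study right multiplication, that is, changes in
  the lower row.\<close>

lemma labelled_blocks_flip_generated:
  assumes "labelled_blocks n (f \<circ> flip) \<in> generated n"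
  shows "labelled_blocks n f \<in> generated n"
  using generated_flip[OF assms] by (simp add: labelled_blocks_flip)

section \<open>Labellings of products with a given right factor\<close>

lemma wedge_e_bar:
  "wedge (e_bar n i) = {{Middle i}, {Lower i}} \<union> {{Middle j, Lower j} | j. j \<in> {1..n} - {i}}"
  and wedge_o_bar: "wedge (o_bar n i) = {{Middle j, Lower j} | j. j \<in> {1..n} - {i}}"
  and wedge_t_bar: "wedge (t_bar n i j) = {{Middle i, Middle j, Lower i, Lower j}} \<union>
     {{Middle k, Lower k} | k. k \<in> {1..n} - {i, j}}"
  by (simp_all add: wedge_def e_bar_def o_bar_def t_bar_def setcompr_eq_image image_Un image_image)

lemma wedge_adj: "B \<in> wedge \<beta> \<Longrightarrow> x \<in> B \<Longrightarrow> y \<in> B \<Longrightarrow> (x, y) \<in> (product_adj \<alpha> \<beta>)\<^sup>*"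
  unfolding product_adj_def by (rule r_into_rtrancl) blast

lemma labelled_blocks_cong:
  assumes "\<And>x. x \<in> upper n \<union> lower n \<Longrightarrow> f x = g x"
  shows "labelled_blocks n f = labelled_blocks n g"
proof -
  have "{x \<in> upper n \<union> lower n. f x \<noteq> 0} = {x \<in> upper n \<union> lower n. g x \<noteq> 0}"
    using assms by auto
  moreover have "{y \<in> upper n \<union> lower n. f y = f x} = {y \<in> upper n \<union> lower n. g y = g x}"
    if "x \<in> upper n \<union> lower n" for x
    using assms that by auto
  ultimately show ?thesis
    unfolding labelled_blocks_def by (intro image_cong) auto
qed

text \<open>A labelling of the outer rows determines the product, but the product graph also needs
  labels in the middle; \<open>m\<close> supplies them.\<close>

fun extend_label :: "(vertex \<Rightarrow> nat) \<Rightarrow> (nat \<Rightarrow> nat) \<Rightarrow> vertex \<Rightarrow> nat" where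
  "extend_label f m (Middle i) = m i"
| "extend_label f m (Upper i) = f (Upper i)"
| "extend_label f m (Lower i) = f (Lower i)"

lemma labelled_blocks_extend_label: "labelled_blocks n (extend_label f m) = labelled_blocks n f"
  by (rule labelled_blocks_cong) (auto simp: upper_def lower_def)

lemma extend_label_lower_to_middle:
  assumes "x \<in> upper n \<union> lower n" "\<And>i. Upper i \<in> upper n \<Longrightarrow> f (Upper i) = g (Upper i)"
  shows "extend_label f (\<lambda>i. g (Lower i)) (lower_to_middle x) = g x"
  using assms by (cases x) auto

text \<open>The labelling \<open>h\<close> describes the left factor and \<open>f\<close> the
  product. The labelling \<open>g\<close> gives each vertex of the left factor the label of its copy
  in the product graph, so its lower values become the middle values of \<open>k\<close>. All
  conditions are thereby stated on two rows, and a lower vertex has to make at most one step through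
  a block of \<beta>.\<close>

lemma rook_mult_extend_label:
  fixes f g h :: "vertex \<Rightarrow> nat"
  defines "k \<equiv> extend_label f (\<lambda>i. g (Lower i))"
  assumes g: "\<And>i. Upper i \<in> upper n \<Longrightarrow> f (Upper i) = g (Upper i)"
    and vee: "\<And>x y. x \<in> upper n \<union> lower n \<Longrightarrow> y \<in> upper n \<union> lower n \<Longrightarrow> h x = h y \<Longrightarrow> h x \<noteq> 0 \<Longrightarrow>
      g x = g y"
    and vee_dot: "\<And>x. x \<in> upper n \<union> lower n \<Longrightarrow> h x = 0 \<Longrightarrow> g x = 0"
    and wedge: "\<And>B x y. B \<in> wedge \<beta> \<Longrightarrow> x \<in> B \<Longrightarrow> y \<in> B \<Longrightarrow> k x = k y"
    and wedge_dot: "\<And>i. i \<in> {1..n} \<Longrightarrow> Middle i \<notin> \<Union>(wedge \<beta>) \<Longrightarrow> g (Lower i) = 0"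
      "\<And>i. i \<in> {1..n} \<Longrightarrow> Lower i \<notin> \<Union>(wedge \<beta>) \<Longrightarrow> f (Lower i) = 0"
    and upper_reach: "\<And>i. i \<in> {1..n} \<Longrightarrow> h (Upper i) = f (Upper i)"
    and lower_reach: "\<And>i. i \<in> {1..n} \<Longrightarrow>
      (\<exists>j \<in> {1..n}. h (Lower j) = f (Lower i) \<and> (\<exists>B \<in> wedge \<beta>. Lower i \<in> B \<and> Middle j \<in> B)) \<or>
      f (Lower i) = 0 \<and> Lower i \<notin> \<Union>(wedge \<beta>) \<or>
      f (Lower i) \<noteq> 0 \<and> (\<forall>y \<in> upper n \<union> lower n. f y = f (Lower i) \<longrightarrow> y = Lower i)"
  shows "rook_mult n (labelled_blocks n h) \<beta> = labelled_blocks n f"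
proof -
  have kl: "k (lower_to_middle x) = g x" if "x \<in> upper n \<union> lower n" for x
    unfolding k_def using that g by (rule extend_label_lower_to_middle)
  have kf: "k x = f x" if "x \<in> upper n \<union> lower n" for x
    using that by (cases x) (auto simp: k_def)
  have "rook_mult n (labelled_blocks n h) \<beta> = labelled_blocks n k"
  proof (rule rook_mult_labelled_blocks)
    fix x assume x: "x \<in> upper n \<union> lower n"
    show "(\<exists>y \<in> upper n \<union> lower n. h y = k x \<and>
        (x, lower_to_middle y) \<in> (product_adj (labelled_blocks n h) \<beta>)\<^sup>*) \<or>
      k x = 0 \<and> x \<in> white n (labelled_blocks n h) \<beta> \<or>
      k x \<noteq> 0 \<and> (\<forall>y \<in> upper n \<union> lower n. k y = k x \<longrightarrow> y = x)"
    proof (cases x)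
      case (Upper i)
      then have "h x = k x" "lower_to_middle x = x"
        using x upper_reach[of i] kf[OF x] by auto
      then show ?thesis
        using x by (metis rtrancl.rtrancl_refl)
    next
      case (Lower i)
      then have i: "i \<in> {1..n}" and kx: "k x = f (Lower i)"
        using x by (auto simp: kf)
      consider (step) j B where "j \<in> {1..n}" "h (Lower j) = f (Lower i)" "B \<in> wedge \<beta>"
          "Lower i \<in> B" "Middle j \<in> B"
        | (dot) "f (Lower i) = 0" "Lower i \<notin> \<Union>(wedge \<beta>)"
        | (single) "f (Lower i) \<noteq> 0" "\<forall>y \<in> upper n \<union> lower n. f y = f (Lower i) \<longrightarrow> y = Lower i"
        using lower_reach[OF i] by metis
      then show ?thesis
      proof cases
        case step
        then have "Lower j \<in> upper n \<union> lower n" "h (Lower j) = k x"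
          "(x, lower_to_middle (Lower j)) \<in> (product_adj (labelled_blocks n h) \<beta>)\<^sup>*"
          using kx wedge_adj[of B \<beta> "Lower i" "Middle j"] Lower by simp_all
        then show ?thesis
          by blast
      next
        case dot
        then have "x \<in> white n (labelled_blocks n h) \<beta>"
          using x Lower by (simp add: white_def)
        then show ?thesis
          using dot kx by simp
      next
        case single
        then show ?thesis
          unfolding kx using Lower kf by simp
      qed
    qed (use x in simp)
  next
    fix w assume w: "w \<in> middle n \<union> lower n" "w \<notin> \<Union>(wedge \<beta>)"
    then show "k w = 0"
      using wedge_dot by (cases w) (simp_all add: k_def)
  next
    fix x y assume xy: "x \<in> upper n \<union> lower n" "y \<in> upper n \<union> lower n" "h x = h y" "h x \<noteq> 0"
    then show "k (lower_to_middle x) = k (lower_to_middle y)"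
      using vee[OF xy] kl by metis
  next
    fix x assume "x \<in> upper n \<union> lower n" "h x = 0"
    then show "k (lower_to_middle x) = 0"
      using vee_dot kl by metis
  qed (rule wedge)
  then show ?thesis
    by (simp add: k_def labelled_blocks_extend_label)
qed

text \<open>In the left factor \<open>j'\<close> is a singleton block, since \<open>c\<close> is
  fresh. Multiplying by \<open>t_bar n i j\<close> joins it to the class of \<open>i'\<close>, or to
  the rook dots if \<open>i'\<close> is one; this restores \<open>f\<close>.\<close>

lemma generated_merge_lower:
  assumes ij: "i \<in> {1..n}" "j \<in> {1..n}" "i \<noteq> j" and eq: "f (Lower i) = f (Lower j)"
    and c: "c \<noteq> 0" "c \<notin> f ` (upper n \<union> lower n)"
    and gen: "labelled_blocks n (f(Lower j := c)) \<in> generated n"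
  shows "labelled_blocks n f \<in> generated n"
proof -
  have "rook_mult n (labelled_blocks n (f(Lower j := c))) (t_bar n i j) = labelled_blocks n f"
  proof (rule rook_mult_extend_label[where g = f])
    fix l assume l: "l \<in> {1..n}"
    then consider "l = j" | "l = i" | "l \<notin> {i, j}"
      by auto
    then show "(\<exists>m \<in> {1..n}. (f(Lower j := c)) (Lower m) = f (Lower l) \<and>
        (\<exists>B \<in> wedge (t_bar n i j). Lower l \<in> B \<and> Middle m \<in> B)) \<or>
      f (Lower l) = 0 \<and> Lower l \<notin> \<Union>(wedge (t_bar n i j)) \<or>
      f (Lower l) \<noteq> 0 \<and> (\<forall>y \<in> upper n \<union> lower n. f y = f (Lower l) \<longrightarrow> y = Lower l)"
    proof cases
      \<comment> \<open>In the left factor \<open>j'\<close> carries the fresh label, so the wanted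
        label is found at \<open>i'\<close>, through the large block of
        \<open>t_bar n i j\<close>.\<close>
      case 1
      then show ?thesis
        using ij eq by (intro disjI1 bexI[of _ i]) (auto simp: wedge_t_bar)
    next
      case 2
      then show ?thesis
        using ij eq by (intro disjI1 bexI[of _ i]) (auto simp: wedge_t_bar)
    next
      case 3
      then have "{Middle l, Lower l} \<in> wedge (t_bar n i j)"
        using l by (auto simp: wedge_t_bar)
      then show ?thesis
        using l 3 by (intro disjI1 bexI[of _ l]) auto
    qed
  next
    fix x y assume "x \<in> upper n \<union> lower n" "y \<in> upper n \<union> lower n"
      "(f(Lower j := c)) x = (f(Lower j := c)) y"
    then show "f x = f y"
      using c by (auto split: if_splits)
  next
    fix B x y assume "B \<in> wedge (t_bar n i j)" "x \<in> B" "y \<in> B"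
    then show "extend_label f (\<lambda>i. f (Lower i)) x = extend_label f (\<lambda>i. f (Lower i)) y"
      using eq by (auto simp: wedge_t_bar)
  next
    fix l assume l: "l \<in> {1..n}"
    then have "l \<in> {i, j} \<or> {Middle l, Lower l} \<in> wedge (t_bar n i j)"
      by (auto simp: wedge_t_bar)
    then have "Middle l \<in> \<Union>(wedge (t_bar n i j))" "Lower l \<in> \<Union>(wedge (t_bar n i j))"
      by (auto simp: wedge_t_bar)
    then show "Middle l \<notin> \<Union>(wedge (t_bar n i j)) \<Longrightarrow> f (Lower l) = 0"
      "Lower l \<notin> \<Union>(wedge (t_bar n i j)) \<Longrightarrow> f (Lower l) = 0"
      by auto
  qed (use c in \<open>auto split: if_splits\<close>)
  then show ?thesis
    using rook_mult_generated[OF gen t_bar_generated[OF ij]] by simp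
qed

text \<open>Multiplication by \<open>o_bar n j\<close> turns the whole class of \<open>j'\<close>
  into rook dots. In the left factor this class is just \<open>{j'}\<close>, so nothing else
  changes.\<close>

lemma generated_dot_lower:
  assumes j: "j \<in> {1..n}" and eq: "f (Lower j) = 0"
    and c: "c \<noteq> 0" "c \<notin> f ` (upper n \<union> lower n)"
    and gen: "labelled_blocks n (f(Lower j := c)) \<in> generated n"
  shows "labelled_blocks n f \<in> generated n"
proof -
  have cover: "{Middle l, Lower l} \<in> wedge (o_bar n j)" if "l \<in> {1..n}" "l \<noteq> j" for l
    using that by (auto simp: wedge_o_bar)
  have "rook_mult n (labelled_blocks n (f(Lower j := c))) (o_bar n j) = labelled_blocks n f"
  proof (rule rook_mult_extend_label[where g = f])
    fix l assume l: "l \<in> {1..n}"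
    show "(\<exists>m \<in> {1..n}. (f(Lower j := c)) (Lower m) = f (Lower l) \<and>
        (\<exists>B \<in> wedge (o_bar n j). Lower l \<in> B \<and> Middle m \<in> B)) \<or>
      f (Lower l) = 0 \<and> Lower l \<notin> \<Union>(wedge (o_bar n j)) \<or>
      f (Lower l) \<noteq> 0 \<and> (\<forall>y \<in> upper n \<union> lower n. f y = f (Lower l) \<longrightarrow> y = Lower l)"
    proof (cases "l = j")
      case True
      then show ?thesis
        using eq by (auto simp: wedge_o_bar)
    next
      case False
      then show ?thesis
        using l cover[OF l] by (intro disjI1 bexI[of _ l]) auto
    qed
    show "f (Lower l) = 0" if "Middle l \<notin> \<Union>(wedge (o_bar n j))"
      using that cover[OF l] eq by (cases "l = j") auto
    show "f (Lower l) = 0" if "Lower l \<notin> \<Union>(wedge (o_bar n j))"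
      using that cover[OF l] eq by (cases "l = j") auto
  next
    fix x y assume "x \<in> upper n \<union> lower n" "y \<in> upper n \<union> lower n"
      "(f(Lower j := c)) x = (f(Lower j := c)) y"
    then show "f x = f y"
      using c by (auto split: if_splits)
  next
    fix B x y assume "B \<in> wedge (o_bar n j)" "x \<in> B" "y \<in> B"
    then show "extend_label f (\<lambda>i. f (Lower i)) x = extend_label f (\<lambda>i. f (Lower i)) y"
      by (auto simp: wedge_o_bar)
  qed (use c in \<open>auto split: if_splits\<close>)
  then show ?thesis
    using rook_mult_generated[OF gen o_bar_generated[OF j]] by simp
qed

text \<open>Such a singleton block is the hole of the sliding puzzle.\<close>

definition isolated :: "nat \<Rightarrow> (vertex \<Rightarrow> nat) \<Rightarrow> vertex \<Rightarrow> bool" where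
  "isolated n f z \<longleftrightarrow> z \<in> upper n \<union> lower n \<and> f z \<noteq> 0 \<and>
     (\<forall>y \<in> upper n \<union> lower n. f y = f z \<longrightarrow> y = z)"

text \<open>Multiplication by \<open>e_bar n j\<close> cuts \<open>j'\<close> off from its class and
  puts a new singleton in its place. The former label \<open>d\<close> may therefore be chosen at
  will, in particular as the label of any other block.\<close>

lemma generated_isolate_lower:
  assumes iso: "isolated n f (Lower j)"
    and gen: "labelled_blocks n (f(Lower j := d)) \<in> generated n"
  shows "labelled_blocks n f \<in> generated n"
proof -
  have j: "j \<in> {1..n}"
    using iso by (auto simp: isolated_def)
  have cover: "{Middle l, Lower l} \<in> wedge (e_bar n j)" if "l \<in> {1..n}" "l \<noteq> j" for l
    using that by (auto simp: wedge_e_bar)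
  have cover_j: "{Middle j} \<in> wedge (e_bar n j)" "{Lower j} \<in> wedge (e_bar n j)"
    by (auto simp: wedge_e_bar)
  have "rook_mult n (labelled_blocks n (f(Lower j := d))) (e_bar n j) = labelled_blocks n f"
  \<comment> \<open>The middle copy of \<open>j'\<close> keeps the label \<open>d\<close> of the
    left factor; the new \<open>j'\<close> below it falls under the last alternative, being alone in
    its fibre.\<close>
  proof (rule rook_mult_extend_label[where g = "f(Lower j := d)"])
    fix l assume l: "l \<in> {1..n}"
    show "(\<exists>m \<in> {1..n}. (f(Lower j := d)) (Lower m) = f (Lower l) \<and>
        (\<exists>B \<in> wedge (e_bar n j). Lower l \<in> B \<and> Middle m \<in> B)) \<or>
      f (Lower l) = 0 \<and> Lower l \<notin> \<Union>(wedge (e_bar n j)) \<or>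
      f (Lower l) \<noteq> 0 \<and> (\<forall>y \<in> upper n \<union> lower n. f y = f (Lower l) \<longrightarrow> y = Lower l)"
    proof (cases "l = j")
      case True
      then show ?thesis
        using iso by (simp add: isolated_def)
    next
      case False
      then show ?thesis
        using l cover[OF l] by (intro disjI1 bexI[of _ l]) auto
    qed
    show "(f(Lower j := d)) (Lower l) = 0" if "Middle l \<notin> \<Union>(wedge (e_bar n j))"
      using that cover[OF l] cover_j by (cases "l = j") auto
    show "f (Lower l) = 0" if "Lower l \<notin> \<Union>(wedge (e_bar n j))"
      using that cover[OF l] cover_j by (cases "l = j") auto
  next
    fix B x y assume "B \<in> wedge (e_bar n j)" "x \<in> B" "y \<in> B"
    then show "extend_label f (\<lambda>i. (f(Lower j := d)) (Lower i)) x
        = extend_label f (\<lambda>i. (f(Lower j := d)) (Lower i)) y"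
      by (auto simp: wedge_e_bar)
  qed simp_all
  then show ?thesis
    using rook_mult_generated[OF gen e_bar_generated[OF j]] by simp
qed

subsection \<open>Partial matchings\<close>

lemma isolated_flip: "isolated n (f \<circ> flip) z \<longleftrightarrow> isolated n f (flip z)"
proof
  show "isolated n f (flip z)" if "isolated n (f \<circ> flip) z"
    unfolding isolated_def
  proof (intro conjI ballI impI)
    fix y assume y: "y \<in> upper n \<union> lower n" "f y = f (flip z)"
    then have "flip y = z"
      using bspec[of "upper n \<union> lower n" _ "flip y"] that by (auto simp: isolated_def)
    then show "y = flip z"
      by auto
  qed (use that in \<open>auto simp: isolated_def\<close>)
  show "isolated n (f \<circ> flip) z" if "isolated n f (flip z)"
    unfolding isolated_def
  proof (intro conjI ballI impI)
    fix y assume y: "y \<in> upper n \<union> lower n" "(f \<circ> flip) y = (f \<circ> flip) z"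
    then have "flip y = flip z"
      using that by (auto simp: isolated_def)
    then show "y = z"
      by (metis flip_flip)
  qed (use that in \<open>auto simp: isolated_def\<close>)
qed

text \<open>A partial matching between the two rows: each block is a singleton or a pair of an upper
  and a lower vertex, and there are no rook dots.\<close>

definition matching :: "nat \<Rightarrow> (vertex \<Rightarrow> nat) \<Rightarrow> bool" where
  "matching n f \<longleftrightarrow>
     inj_on f (upper n) \<and> inj_on f (lower n) \<and> (\<forall>x \<in> upper n \<union> lower n. f x \<noteq> 0)"

lemma matching_UpperD:
  "matching n f \<Longrightarrow> i \<in> {1..n} \<Longrightarrow> j \<in> {1..n} \<Longrightarrow> f (Upper i) = f (Upper j) \<Longrightarrow> i = j"
  and matching_LowerD:
  "matching n f \<Longrightarrow> i \<in> {1..n} \<Longrightarrow> j \<in> {1..n} \<Longrightarrow> f (Lower i) = f (Lower j) \<Longrightarrow> i = j"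
  by (auto simp: matching_def dest: inj_onD)

lemma matchingI:
  assumes "\<And>i j. i \<in> {1..n} \<Longrightarrow> j \<in> {1..n} \<Longrightarrow> f (Upper i) = f (Upper j) \<Longrightarrow> i = j"
    and "\<And>i j. i \<in> {1..n} \<Longrightarrow> j \<in> {1..n} \<Longrightarrow> f (Lower i) = f (Lower j) \<Longrightarrow> i = j"
    and "\<And>i. i \<in> {1..n} \<Longrightarrow> f (Upper i) \<noteq> 0 \<and> f (Lower i) \<noteq> 0"
  shows "matching n f"
  unfolding matching_def
proof (intro conjI inj_onI ballI)
  fix x y assume "x \<in> upper n" "y \<in> upper n" and eq: "f x = f y"
  then obtain i j where "x = Upper i" "y = Upper j" "i \<in> {1..n}" "j \<in> {1..n}"
    unfolding upper_def by blast
  then show "x = y"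
    using assms(1)[of i j] eq by simp
next
  fix x y assume "x \<in> lower n" "y \<in> lower n" and eq: "f x = f y"
  then obtain i j where "x = Lower i" "y = Lower j" "i \<in> {1..n}" "j \<in> {1..n}"
    unfolding lower_def by blast
  then show "x = y"
    using assms(2)[of i j] eq by simp
next
  fix x assume "x \<in> upper n \<union> lower n"
  then show "f x \<noteq> 0"
    using assms(3) by (cases x) simp_all
qed

lemma matching_flip:
  assumes f: "matching n f"
  shows "matching n (f \<circ> flip)"
proof (rule matchingI)
  fix i j assume ij: "i \<in> {1..n}" "j \<in> {1..n}"
  show "i = j" if "(f \<circ> flip) (Upper i) = (f \<circ> flip) (Upper j)"
    using matching_LowerD[OF f ij] that by simp
  show "i = j" if "(f \<circ> flip) (Lower i) = (f \<circ> flip) (Lower j)"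
    using matching_UpperD[OF f ij] that by simp
qed (use f in \<open>simp add: matching_def\<close>)

section \<open>Moving the hole\<close>

abbreviation swap_lower :: "nat \<Rightarrow> nat \<Rightarrow> (vertex \<Rightarrow> nat) \<Rightarrow> vertex \<Rightarrow> nat" where
  "swap_lower i j f \<equiv> f(Lower i := f (Lower j), Lower j := f (Lower i))"

text \<open>One move of the puzzle, read backwards: insert the singleton \<open>i'\<close> into the
  block of \<open>j'\<close>, then split off \<open>j'\<close>. The hole passes from
  \<open>i'\<close> to \<open>j'\<close>.\<close>

lemma generated_swap_lower:
  assumes iso: "isolated n f (Lower i)" and j: "j \<in> {1..n}" "i \<noteq> j"
    and gen: "labelled_blocks n (swap_lower i j f) \<in> generated n"
  shows "labelled_blocks n f \<in> generated n"
proof -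
  have i: "i \<in> {1..n}"
    using iso by (auto simp: isolated_def)
  let ?g = "f(Lower i := f (Lower j))"
  \<comment> \<open>After the insertion the old label of \<open>i'\<close> occurs nowhere, so it can
    serve as the fresh label for \<open>j'\<close>.\<close>
  have "f (Lower i) \<noteq> 0" "f (Lower i) \<notin> ?g ` (upper n \<union> lower n)"
    using iso j by (auto simp: isolated_def split: if_splits)
  then have "labelled_blocks n ?g \<in> generated n"
    using generated_merge_lower[OF i j(1,2), of ?g "f (Lower i)"] gen j by simp
  then show ?thesis
    by (rule generated_isolate_lower[OF iso])
qed

lemma isolated_swap_lower:
  assumes "isolated n f (Lower i)" "j \<in> {1..n}" "i \<noteq> j"
  shows "isolated n (swap_lower i j f) (Lower j)"
  using assms by (auto simp: isolated_def)

lemma matching_swap_lower: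
  assumes f: "matching n f" and ij: "i \<in> {1..n}" "j \<in> {1..n}"
  shows "matching n (swap_lower i j f)"
proof (rule matchingI)
  fix k l assume kl: "k \<in> {1..n}" "l \<in> {1..n}"
  show "k = l" if "swap_lower i j f (Upper k) = swap_lower i j f (Upper l)"
    using matching_UpperD[OF f kl] that by simp
  show "k = l" if "swap_lower i j f (Lower k) = swap_lower i j f (Lower l)"
    using that matching_LowerD[OF f kl] matching_LowerD[OF f kl(1) ij(1)]
      matching_LowerD[OF f kl(1) ij(2)] matching_LowerD[OF f ij(1) kl(2)]
      matching_LowerD[OF f ij(2) kl(2)] matching_LowerD[OF f ij] by (auto split: if_splits)
next
  fix k assume "k \<in> {1..n}"
  then show "swap_lower i j f (Upper k) \<noteq> 0 \<and> swap_lower i j f (Lower k) \<noteq> 0"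
    using f ij by (simp add: matching_def)
qed

text \<open>Its cardinality is the induction measure of the puzzle; for a matching it counts the
  \<open>i\<close> for which \<open>{i, i'}\<close> is not a block.\<close>

definition moved :: "nat \<Rightarrow> (vertex \<Rightarrow> nat) \<Rightarrow> nat set" where
  "moved n f = {i \<in> {1..n}. f (Upper i) \<noteq> f (Lower i)}"

text \<open>The hole \<open>i'\<close> is filled so that \<open>{i, i'}\<close> becomes a block and
  \<open>i\<close> leaves \<open>moved\<close>. If \<open>i\<close> is a singleton,
  \<open>i'\<close> is inserted there; otherwise \<open>i\<close> is paired with some
  \<open>d'\<close>, and the hole slides to \<open>d'\<close>. Assumption \<open>other\<close>
  ensures that a singleton survives the insertion, as required by the induction hypothesis
  \<open>step\<close>.\<close>

lemma generated_fix_isolated: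
  assumes f: "matching n f" and iso: "isolated n f (Lower i)"
    and step: "\<And>g z. matching n g \<Longrightarrow> isolated n g z \<Longrightarrow> moved n g \<subset> moved n f \<Longrightarrow>
      labelled_blocks n g \<in> generated n"
    and other: "isolated n f (Upper i) \<Longrightarrow> \<exists>b. b \<noteq> i \<and> isolated n f (Upper b)"
  shows "labelled_blocks n f \<in> generated n"
proof -
  have i: "i \<in> {1..n}"
    using iso by (auto simp: isolated_def)
  have uniq: "x = Lower i" if "f x = f (Lower i)" "x \<in> upper n \<union> lower n" for x
    using iso that by (simp add: isolated_def)
  have i_moved: "i \<in> moved n f"
    using uniq[of "Upper i"] i by (auto simp: moved_def)
  show ?thesis
  proof (cases "isolated n f (Upper i)")
    case True
    then obtain b where b: "b \<noteq> i" "isolated n f (Upper b)"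
      using other by blast
    let ?g = "f(Lower i := f (Upper i))"
    have single: "y = Upper i" if "f y = f (Upper i)" "y \<in> upper n \<union> lower n" for y
      using True that by (simp add: isolated_def)
    have "matching n ?g"
    proof (rule matchingI)
      fix k l assume kl: "k \<in> {1..n}" "l \<in> {1..n}"
      show "k = l" if "?g (Upper k) = ?g (Upper l)"
        using matching_UpperD[OF f kl] that by simp
      show "k = l" if "?g (Lower k) = ?g (Lower l)"
        using that single[of "Lower k"] single[of "Lower l"] matching_LowerD[OF f kl] kl
        by (auto split: if_splits)
    next
      fix k assume "k \<in> {1..n}"
      then show "?g (Upper k) \<noteq> 0 \<and> ?g (Lower k) \<noteq> 0"
        using f i by (simp add: matching_def)
    qed
    moreover have "isolated n ?g (Upper b)"
      using b i matching_UpperD[OF f, of i b] by (auto simp: isolated_def)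
    moreover have "moved n ?g \<subset> moved n f"
      using i_moved by (auto simp: moved_def split: if_splits)
    ultimately have "labelled_blocks n ?g \<in> generated n"
      by (rule step)
    then show ?thesis
      by (rule generated_isolate_lower[OF iso])
  next
    case False
    moreover have "f (Upper i) \<noteq> 0"
      using f i by (simp add: matching_def)
    ultimately obtain y where y: "y \<in> upper n \<union> lower n" "f y = f (Upper i)" "y \<noteq> Upper i"
      using i by (auto simp: isolated_def)
    obtain d where "y = Lower d"
    proof (cases y)
      case (Upper j)
      then show ?thesis
        using matching_UpperD[OF f, of j i] y i by simp
    qed (use that y in simp_all)
    then have d: "d \<in> {1..n}" "f (Lower d) = f (Upper i)"
      using y by auto
    then have "d \<noteq> i"
      using uniq[of "Upper i"] i by auto
    let ?g = "swap_lower i d f"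
    \<comment> \<open>As \<open>d\<close> is already misplaced, altering the label of
      \<open>d'\<close> cannot enlarge \<open>moved\<close>.\<close>
    have "d \<in> moved n f"
      using d i \<open>d \<noteq> i\<close> matching_UpperD[OF f, of d i] by (auto simp: moved_def)
    then have "moved n ?g \<subset> moved n f"
      using i_moved d \<open>d \<noteq> i\<close> by (auto simp: moved_def split: if_splits)
    moreover have "isolated n ?g (Lower d)"
      by (rule isolated_swap_lower[OF iso d(1)]) (use \<open>d \<noteq> i\<close> in simp)
    ultimately have "labelled_blocks n ?g \<in> generated n"
      by (intro step matching_swap_lower f i d(1))
    then show ?thesis
      using generated_swap_lower[OF iso d(1)] \<open>d \<noteq> i\<close> by simp
  qed
qed

text \<open>The end position of the puzzle: every \<open>i\<close> other than \<open>b\<close> is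
  paired with \<open>i'\<close>.\<close>

lemma labelled_blocks_eq_e_bar:
  assumes f: "matching n f" and iso: "isolated n f (Lower b)" "isolated n f (Upper b)"
    and mv: "moved n f \<subseteq> {b}"
  shows "labelled_blocks n f = e_bar n b"
proof -
  let ?C = "\<lambda>x. {y \<in> upper n \<union> lower n. f y = f x}"
  have b: "b \<in> {1..n}"
    using iso by (auto simp: isolated_def)
  have single: "?C (Lower b) = {Lower b}" "?C (Upper b) = {Upper b}"
    using iso by (auto simp: isolated_def)
  have eq: "f (Upper i) = f (Lower i)" if "i \<in> {1..n}" "i \<noteq> b" for i
    using mv that by (auto simp: moved_def)
  have pair: "?C (Lower i) = {Upper i, Lower i}" if i: "i \<in> {1..n}" "i \<noteq> b" for i
  proof
    show "?C (Lower i) \<subseteq> {Upper i, Lower i}"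
    proof
      fix y assume y: "y \<in> ?C (Lower i)"
      show "y \<in> {Upper i, Lower i}"
      proof (cases y)
        case (Upper j)
        then show ?thesis
          using y i eq[OF i] matching_UpperD[OF f, of j i] by simp
      next
        case (Lower j)
        then show ?thesis
          using y i matching_LowerD[OF f, of j i] by simp
      qed (use y in simp)
    qed
    show "{Upper i, Lower i} \<subseteq> ?C (Lower i)"
      using i eq[OF i] by simp
  qed
  then have pair': "?C (Upper i) = {Upper i, Lower i}" if i: "i \<in> {1..n}" "i \<noteq> b" for i
    using that eq[OF i] by simp
  have V: "{x \<in> upper n \<union> lower n. f x \<noteq> 0} =
    {Upper b, Lower b} \<union> Upper ` ({1..n} - {b}) \<union> Lower ` ({1..n} - {b})"
    using f b by (auto simp: matching_def upper_def lower_def)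
  have "labelled_blocks n f = {{Upper b}, {Lower b}} \<union>
      (\<lambda>i. ?C (Upper i)) ` ({1..n} - {b}) \<union> (\<lambda>i. ?C (Lower i)) ` ({1..n} - {b})"
    unfolding labelled_blocks_def V image_Un image_image image_insert single by simp
  also have "(\<lambda>i. ?C (Upper i)) ` ({1..n} - {b}) = (\<lambda>i. {Upper i, Lower i}) ` ({1..n} - {b})"
    by (rule image_cong[OF refl], rule pair') simp_all
  also have "(\<lambda>i. ?C (Lower i)) ` ({1..n} - {b}) = (\<lambda>i. {Upper i, Lower i}) ` ({1..n} - {b})"
    by (rule image_cong[OF refl], rule pair) simp_all
  finally show ?thesis
    unfolding e_bar_def setcompr_eq_image Collect_mem_eq by blast
qed

lemma generated_matching:
  assumes "matching n f" "isolated n f z"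
  shows "labelled_blocks n f \<in> generated n"
  using assms
proof (induction "card (moved n f)" arbitrary: f z rule: less_induct)
  case less
  have finite: "finite (moved n g)" for g
    by (simp add: moved_def)
  \<comment> \<open>Stated for every labelling, with the induction hypothesis as an assumption, so
    that a hole in the upper row can be treated by applying it to the exchanged labelling.\<close>
  have lower: "labelled_blocks n f \<in> generated n"
    if f: "matching n f" and iso: "isolated n f (Lower b)"
      and IH: "\<And>g z. matching n g \<Longrightarrow> isolated n g z \<Longrightarrow> moved n g \<subset> moved n f \<Longrightarrow>
        labelled_blocks n g \<in> generated n" for f b
  proof (cases "isolated n f (Upper b) \<and> \<not> moved n f \<subseteq> {b}")
    case False
    show ?thesis
    proof (cases "isolated n f (Upper b)")
      case True
      then have "labelled_blocks n f = e_bar n b"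
        using labelled_blocks_eq_e_bar[OF f iso] False by blast
      moreover have "b \<in> {1..n}"
        using iso by (auto simp: isolated_def)
      ultimately show ?thesis
        by (simp only: e_bar_generated)
    next
      \<comment> \<open>Assumption \<open>other\<close> holds vacuously here, so the hole at
        \<open>b'\<close> can be filled at once.\<close>
      case False
      show ?thesis
        by (rule generated_fix_isolated[OF f iso]) (erule (2) IH, use False in blast)
    qed
  next
    \<comment> \<open>Filling \<open>b'\<close> from \<open>b\<close> might use up the last
      singletons and leave a unit. Instead the hole first slides to another misplaced
      \<open>i'\<close>; then \<open>b\<close> remains as a spare singleton while \<open>i\<close>
      is put right.\<close>
    case True
    have b: "b \<in> {1..n}"
      using iso by (auto simp: isolated_def)
    obtain i where i: "i \<in> moved n f" "i \<noteq> b" "i \<in> {1..n}"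
      using True by (auto simp: moved_def)
    let ?g = "swap_lower b i f"
    have "b \<in> moved n f"
      using iso b by (auto simp: moved_def isolated_def)
    \<comment> \<open>Both \<open>b\<close> and \<open>i\<close> are misplaced beforehand, so the
      slide adds nothing to \<open>moved\<close>.\<close>
    then have sub: "moved n ?g \<subseteq> moved n f"
      using i by (auto simp: moved_def split: if_splits)
    have g: "matching n ?g" "isolated n ?g (Lower i)"
      using matching_swap_lower[OF f b i(3)] isolated_swap_lower[OF iso i(3)] i(2) by auto
    have "isolated n ?g (Upper b)"
      using True i b by (auto simp: isolated_def split: if_splits)
    have "labelled_blocks n ?g \<in> generated n"
    proof (rule generated_fix_isolated[OF g])
      show "labelled_blocks n h \<in> generated n"
        if "matching n h" "isolated n h z" "moved n h \<subset> moved n ?g" for h z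
        using that sub by (intro IH[of h z]) blast+
      show "\<exists>c. c \<noteq> i \<and> isolated n ?g (Upper c)"
        using \<open>isolated n ?g (Upper b)\<close> i(2) by metis
    qed
    then show ?thesis
      using generated_swap_lower[OF iso i(3)] i(2) by simp
  qed
  have IH: "labelled_blocks n g \<in> generated n"
    if "matching n g" "isolated n g z" "moved n g \<subset> moved n f" for g z
    using less.hyps[OF psubset_card_mono[OF finite that(3)] that(1,2)] .
  show ?case
  proof (cases z)
    case (Upper b)
    have flip: "moved n (g \<circ> flip) = moved n g" for g
      by (auto simp: moved_def)
    have "labelled_blocks n (f \<circ> flip) \<in> generated n"
    proof (rule lower)
      show "matching n (f \<circ> flip)" "isolated n (f \<circ> flip) (Lower b)"
        using less.prems Upper by (simp_all add: matching_flip isolated_flip)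
      show "labelled_blocks n g \<in> generated n"
        if "matching n g" "isolated n g z" "moved n g \<subset> moved n (f \<circ> flip)" for g z
        using that unfolding flip by (rule IH)
    qed
    then show ?thesis
      by (rule labelled_blocks_flip_generated)
  next
    case (Lower b)
    then have "isolated n f (Lower b)"
      using less.prems by simp
    from less.prems(1) this IH show ?thesis
      by (rule lower)
  qed (use less.prems in \<open>simp add: isolated_def\<close>)
qed

subsection \<open>Reduction to partial matchings\<close>

text \<open>The vertices that obstruct \<open>matching\<close>: rook dots and vertices sharing a
  block within their row. Singleton blocks are not among them.\<close>

definition unmatched :: "nat \<Rightarrow> (vertex \<Rightarrow> nat) \<Rightarrow> vertex set" where
  "unmatched n f = {y \<in> upper n \<union> lower n. f y = 0 \<or>
     (\<exists>x \<in> upper n \<union> lower n. x \<noteq> y \<and> (x \<in> upper n \<longleftrightarrow> y \<in> upper n) \<and> f x = f y)}"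

text \<open>For a lower vertex, a rook dot is split off by means of \<open>o_bar\<close> and a
  vertex sharing its label within the row by means of \<open>t_bar\<close>; upper vertices follow by
  exchanging the rows.\<close>

lemma generated_unmatched:
  assumes y: "y \<in> unmatched n f" and c: "c \<noteq> 0" "c \<notin> f ` (upper n \<union> lower n)"
    and gen: "labelled_blocks n (f(y := c)) \<in> generated n"
  shows "labelled_blocks n f \<in> generated n"
proof -
  have lower: "labelled_blocks n f \<in> generated n"
    if j: "Lower j \<in> unmatched n f" and c: "c \<notin> f ` (upper n \<union> lower n)"
      and gen: "labelled_blocks n (f(Lower j := c)) \<in> generated n" for f j
  proof (cases "f (Lower j) = 0")
    case True
    then show ?thesis
      using generated_dot_lower[of j n f c] j c \<open>c \<noteq> 0\<close> gen by (auto simp: unmatched_def)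
  next
    case False
    then obtain x where x: "x \<in> lower n" "x \<noteq> Lower j" "f x = f (Lower j)"
      using j by (auto simp: unmatched_def)
    then obtain i where "x = Lower i" "i \<in> {1..n}"
      by (auto simp: lower_def)
    then show ?thesis
      using generated_merge_lower[of i n j f c] x j c \<open>c \<noteq> 0\<close> gen by (auto simp: unmatched_def)
  qed
  show ?thesis
  proof (cases y)
    case (Upper j)
    have img: "(f \<circ> flip) ` (upper n \<union> lower n) = f ` (upper n \<union> lower n)"
    proof -
      have "flip ` (upper n \<union> lower n) = upper n \<union> lower n"
        by (auto simp: flip_image_iff)
      then show ?thesis
        by (metis image_comp)
    qed
    have "Lower j \<in> unmatched n (f \<circ> flip)"
    proof (cases "f y = 0")
      case True
      then show ?thesis
        using y Upper by (simp add: unmatched_def)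
    next
      case False
      then obtain x where x: "x \<in> upper n" "x \<noteq> Upper j" "f x = f (Upper j)"
        using y Upper by (auto simp: unmatched_def)
      then have "flip x \<in> lower n" "flip x \<noteq> Lower j" "(f \<circ> flip) (flip x) = f (Upper j)"
        by (auto) (metis flip.simps(2) flip_flip)
      moreover have "Lower j \<in> lower n"
        using y Upper by (simp add: unmatched_def)
      moreover have "flip x \<notin> upper n"
        using x by (cases x) auto
      ultimately show ?thesis
        unfolding unmatched_def by auto
    qed
    moreover have "(f \<circ> flip)(Lower j := c) = f(Upper j := c) \<circ> flip"
    proof
      show "((f \<circ> flip)(Lower j := c)) v = (f(Upper j := c) \<circ> flip) v" for v
        by (cases v) auto
    qed
    moreover have "labelled_blocks n (f(Upper j := c) \<circ> flip) \<in> generated n"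
      using generated_flip[OF gen] Upper by (simp add: labelled_blocks_flip)
    ultimately have "labelled_blocks n (f \<circ> flip) \<in> generated n"
      using lower[of j "f \<circ> flip"] c img by simp
    then show ?thesis
      by (rule labelled_blocks_flip_generated)
  next
    case (Lower j)
    then show ?thesis
      using lower y c gen by simp
  qed (use y in \<open>simp add: unmatched_def\<close>)
qed

lemma matching_if_unmatched_empty:
  assumes "unmatched n f = {}"
  shows "matching n f"
  unfolding matching_def
proof (intro conjI inj_onI ballI notI)
  fix x y assume "x \<in> upper n" "y \<in> upper n" "f x = f y"
  then show "x = y"
    using assms unfolding unmatched_def by blast
next
  fix x y assume xy: "x \<in> lower n" "y \<in> lower n" "f x = f y"
  then have "x \<notin> upper n" "y \<notin> upper n"
    by (auto simp: lower_def)
  then show "x = y"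
    using assms xy unfolding unmatched_def by blast
next
  fix x assume "x \<in> upper n \<union> lower n" "f x = 0"
  then show False
    using assms unfolding unmatched_def by blast
qed

lemma fresh_label:
  fixes f :: "vertex \<Rightarrow> nat"
  obtains c where "c \<noteq> 0" "c \<notin> f ` (upper n \<union> lower n)"
proof -
  have "finite (insert 0 (f ` (upper n \<union> lower n)))"
    using finite_vertices by blast
  then obtain c where "c \<notin> insert 0 (f ` (upper n \<union> lower n))"
    using ex_new_if_finite infinite_UNIV_nat by metis
  then show thesis
    using that by blast
qed

text \<open>Splitting off an unmatched vertex removes it from \<open>unmatched\<close> and adds no
  other, so induction ends at a matching. The singleton \<open>z\<close> is never the vertex split
  off, hence it survives as the hole.\<close>

lemma generated_isolated:
  assumes "isolated n f z"
  shows "labelled_blocks n f \<in> generated n"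
  using assms
proof (induction "card (unmatched n f)" arbitrary: f rule: less_induct)
  case less
  show ?case
  proof (cases "unmatched n f = {}")
    case True
    then show ?thesis
      using generated_matching matching_if_unmatched_empty less.prems by blast
  next
    case False
    then obtain y where y: "y \<in> unmatched n f"
      by blast
    obtain c where c: "c \<noteq> 0" "c \<notin> f ` (upper n \<union> lower n)"
      using fresh_label by metis
    have fresh: "f x \<noteq> c" if "x \<in> upper n \<union> lower n" for x
      using c(2) that by blast
    have "y \<noteq> z"
      using less.prems y unfolding isolated_def unmatched_def by blast
    then have "isolated n (f(y := c)) z"
      using less.prems fresh[of z] by (simp add: isolated_def)
    moreover have "unmatched n (f(y := c)) \<subset> unmatched n f"
    proof
      show "unmatched n (f(y := c)) \<subseteq> unmatched n f"
      proof
        fix x assume x: "x \<in> unmatched n (f(y := c))"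
        have "x \<noteq> y"
          using x c fresh by (auto simp: unmatched_def)
        then show "x \<in> unmatched n f"
          using x fresh[of x] unfolding unmatched_def by (auto split: if_splits)
      qed
      have "y \<notin> unmatched n (f(y := c))"
        using c fresh by (auto simp: unmatched_def)
      then show "unmatched n (f(y := c)) \<noteq> unmatched n f"
        using y by blast
    qed
    moreover have "finite (unmatched n f)"
      by (simp add: unmatched_def finite_vertices[unfolded finite_Un])
    ultimately have "labelled_blocks n (f(y := c)) \<in> generated n"
      using less.hyps[OF psubset_card_mono] by blast
    then show ?thesis
      using generated_unmatched y c by blast
  qed
qed

text \<open>A singleton block is needed to start. A matching that is not a unit has one, namely the
  block of an upper vertex violating \<open>rook_units_iff\<close>. In all other cases, splitting
  off any unmatched vertex creates one.\<close>

lemma generated_if_not_unit: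
  assumes "\<alpha> \<in> rook_partitions n" "\<alpha> \<notin> rook_units n"
  shows "\<alpha> \<in> generated n"
proof -
  obtain f where \<alpha>: "\<alpha> = labelled_blocks n f"
    using assms(1) by (rule labelled_blocks_exists)
  show ?thesis
  proof (cases "unmatched n f = {}")
    case True
    then have f: "matching n f"
      by (rule matching_if_unmatched_empty)
    obtain x where x: "x \<in> upper n" "\<And>B. B \<in> \<alpha> \<Longrightarrow> B \<inter> upper n = {x} \<Longrightarrow> B \<inter> lower n = {}"
      using assms rook_units_iff by metis
    let ?B = "{y \<in> upper n \<union> lower n. f y = f x}"
    have "?B \<in> \<alpha>"
      unfolding \<alpha> labelled_blocks_def using f x(1) by (auto simp: matching_def)
    moreover have "?B \<inter> upper n = {x}"
      using f x(1) by (auto simp: matching_def dest: inj_onD)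
    ultimately have "?B \<inter> lower n = {}"
      by (rule x(2))
    then have "isolated n f x"
      using f x(1) by (auto simp: isolated_def matching_def dest: inj_onD)
    then show ?thesis
      unfolding \<alpha> by (rule generated_isolated)
  next
    case False
    then obtain y where y: "y \<in> unmatched n f"
      by blast
    obtain c where c: "c \<noteq> 0" "c \<notin> f ` (upper n \<union> lower n)"
      using fresh_label by metis
    then have "isolated n (f(y := c)) y"
      using y by (auto simp: isolated_def unmatched_def)
    then have "labelled_blocks n (f(y := c)) \<in> generated n"
      by (rule generated_isolated)
    then show ?thesis
      unfolding \<alpha> using generated_unmatched y c by blast
  qed
qed

section \<open>Products of generators are singular\<close>

lemma generators_rook_partitions:
  assumes "\<alpha> \<in> generators n"
  shows "\<alpha> \<in> rook_partitions n"
  using assms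
proof (elim UnE CollectE exE conjE)
  show "\<alpha> \<in> rook_partitions n" if "\<alpha> = e_bar n i" "1 \<le> i" "i \<le> n" for i
    using that by (auto simp: rook_partitions_def e_bar_def disjoint_def)
  show "\<alpha> \<in> rook_partitions n" if "\<alpha> = t_bar n i j" "1 \<le> i" "i < j" "j \<le> n" for i j
    using that by (auto simp: rook_partitions_def t_bar_def disjoint_def)
  show "\<alpha> \<in> rook_partitions n" if "\<alpha> = o_bar n i" "1 \<le> i" "i \<le> n" for i
    using that by (auto simp: rook_partitions_def o_bar_def disjoint_def)
qed

text \<open>The criterion fails at the upper vertex \<open>i\<close>: its block has no lower vertex
  in \<open>e_bar\<close>, contains a second upper vertex in \<open>t_bar\<close>, and does not
  exist in \<open>o_bar\<close>.\<close>

lemma generators_not_unit: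
  assumes "\<alpha> \<in> generators n"
  shows "\<alpha> \<notin> rook_units n"
proof
  assume "\<alpha> \<in> rook_units n"
  then have unit: "\<exists>B\<in>\<alpha>. B \<inter> upper n = {Upper i} \<and> B \<inter> lower n \<noteq> {}" if "1 \<le> i" "i \<le> n" for i
    using rook_units_iff[OF generators_rook_partitions[OF assms]] that by simp
  show False
    using assms
  proof (elim UnE CollectE exE conjE)
    fix i assume i: "\<alpha> = e_bar n i" "1 \<le> i" "i \<le> n"
    obtain B where B: "B \<in> \<alpha>" "B \<inter> upper n = {Upper i}" "B \<inter> lower n \<noteq> {}"
      using unit[OF i(2,3)] by blast
    then have "Upper i \<in> B"
      by blast
    then have "B = {Upper i}"
      using B(1) unfolding i(1) e_bar_def by auto
    then show False
      using B(3) by simp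
  next
    fix i j assume ij: "\<alpha> = t_bar n i j" "1 \<le> i" "i < j" "j \<le> n"
    then obtain B where B: "B \<in> \<alpha>" "B \<inter> upper n = {Upper i}"
      using unit[of i] by auto
    then have "Upper i \<in> B"
      by blast
    then have "B = {Upper i, Upper j, Lower i, Lower j}"
      using B(1) unfolding ij(1) t_bar_def by auto
    then have "Upper j \<in> B \<inter> upper n"
      using ij by simp
    then show False
      using B(2) ij(3) by simp
  next
    fix i assume i: "\<alpha> = o_bar n i" "1 \<le> i" "i \<le> n"
    then obtain B where B: "B \<in> \<alpha>" "B \<inter> upper n = {Upper i}"
      using unit[of i] by blast
    then have "Upper i \<in> B"
      by blast
    then show False
      using B(1) unfolding i(1) o_bar_def by auto
  qed
qed

lemma generated_not_unit:
  assumes "\<alpha> \<in> generated n"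
  shows "\<alpha> \<in> rook_partitions n - rook_units n"
  using assms
proof (induction rule: semigroup_generate.induct)
  case (incl \<alpha>)
  then show ?case
    by (intro DiffI generators_rook_partitions generators_not_unit)
next
  case (mult \<alpha> \<beta>)
  have eq: "\<alpha> \<otimes>\<^bsub>rook_monoid n\<^esub> \<beta> = rook_mult n \<alpha> \<beta>"
    by (simp add: rook_monoid_def)
  show ?case
    unfolding eq
  proof
    show "rook_mult n \<alpha> \<beta> \<notin> rook_units n"
      \<comment> \<open>If the product were a unit, its left factor would be one, against the
        induction hypothesis.\<close>
      using rook_units_of_rook_mult[of \<alpha> n \<beta>] mult.IH(1) by blast
  qed (rule rook_mult_in_rook_partitions)
qed

theorem proposition3p1:
  fixes n :: nat
  shows "carrier (rook_monoid n) - rook_units n =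
    semigroup_generate (rook_monoid n)
      ({e_bar n i | i. 1 \<le> i \<and> i \<le> n}
       \<union> {t_bar n i j | i j. 1 \<le> i \<and> i < j \<and> j \<le> n}
       \<union> {o_bar n i | i. 1 \<le> i \<and> i \<le> n})"
proof
  have carrier: "carrier (rook_monoid n) = rook_partitions n"
    by (simp add: rook_monoid_def)
  show "carrier (rook_monoid n) - rook_units n \<subseteq> generated n"
    unfolding carrier
  proof
    fix \<alpha> assume "\<alpha> \<in> rook_partitions n - rook_units n"
    then show "\<alpha> \<in> generated n"
      by (elim DiffE) (rule generated_if_not_unit)
  qed
  show "generated n \<subseteq> carrier (rook_monoid n) - rook_units n"
    unfolding carrier by (rule subsetI) (rule generated_not_unit)
qed

end
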